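(* Let $\lambda,k>0$ and $\alpha>0$. Let $G$ be a Gamma random variable with parameters $\lambda,k$ (density $\frac{\lambda^k}{\Gamma(k)}e^{-\lambda z}z^{k-1}$, $z>0$), and let $B^{el}_\alpha(t)$, $t>0$, be the elastic Brownian motion with absorbing rate $\alpha$, independent of $G$, whose one-dimensional law is $q^{el}_\alpha(s,t)$. Then, for $t>0$, the crossing probability of $G$ by $B^{el}_\alpha(t)$ is $$\psi^{el}_{k,\alpha}(t)=\Pr\{B^{el}_\alpha(t)<G\}=1-\left(\frac{\lambda\sqrt t}{\sqrt2}\right)^k\sum_{l=0}^\infty\left(-\frac{\alpha\sqrt t}{\sqrt2}\right)^lE^k_{\frac12,\frac{l+k}2+1}\left(-\frac{\lambda\sqrt t}{\sqrt2}\right),$$ which, in the particular case $\alpha=\lambda$, reduces to $$\psi^{el}_{k,\lambda}(t)=\Pr\{B^{el}_\lambda(t)<G\}=1-\left(\frac{\lambda\sqrt t}{\sqrt2}\right)^kE^{k+1}_{\frac12,\frac k2+1}\left(-\frac{\lambda\sqrt t}{\sqrt2}\right).$$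
   Context: The elastic Brownian motion with absorbing rate $\alpha>0$ is $B^{el}_\alpha(t)=|B(t)|$ for $t<T_\alpha$ and $B^{el}_\alpha(t)=0$ for $t\ge T_\alpha$, where $B$ is a standard Brownian motion from $0$ ($\operatorname{Var}B(t)=t$) and $T_\alpha$ is a random time with $\Pr\{T_\alpha>t\mid\mathcal{B}_t\}=e^{-\alpha L(0,t)}$, $\mathcal{B}_t=\sigma\{B(s),s\le t\}$, $L(0,t)=\lim_{\varepsilon\downarrow0}\frac{1}{2\varepsilon}\mathrm{meas}\{s\le t:|B(s)|<\varepsilon\}$. Its one-dimensional law is (a well-known fact, which may be taken as the definition of the law) $$q^{el}_\alpha(s,t)=2e^{\alpha s}\int_s^{+\infty}we^{-\alpha w}\frac{e^{-\frac{w^2}{2t}}}{\sqrt{2\pi t^3}}\,dw+q_\alpha(t)\,\delta(s),\quad s\ge0,\ t>0,$$ where $\delta$ is the Dirac mass at $0$ and $$q_\alpha(t)=1-2e^{\frac{\alpha^2t}{2}}\int_{\alpha\sqrt t}^{+\infty}\frac{e^{-w^2/2}}{\sqrt{2\pi}}\,dw.$$ Thus $\psi^{el}_{k,\alpha}(t)=\int_{[0,\infty)}[1-F_G(s)]\,q^{el}_\alpha(s,t)\,ds$ with $F_G$ the distribution function of $G$, the atom at $0$ contributing its full mass. The generalized Mittag-Leffler function is $$E^\gamma_{\alpha,\beta}(z)=\sum_{j=0}^\infty\frac{(\gamma)_j\,z^j}{j!\,\Gamma(\alpha j+\beta)},\qquad (\gamma)_0=1,\ (\gamma)_j=\gamma(\gamma+1)\cdots(\gamma+j-1).$$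 *)

theory Defs
  imports "HOL-Probability.Probability"
begin

definition gamma_density :: "real \<Rightarrow> real \<Rightarrow> real \<Rightarrow> real" where
  "gamma_density lam k z =
     (if z > 0 then lam powr k / Gamma k * exp (- lam * z) * z powr (k - 1) else 0)"

definition gen_mittag_leffler :: "real \<Rightarrow> real \<Rightarrow> real \<Rightarrow> real \<Rightarrow> real" where
  "gen_mittag_leffler \<gamma> a b z =
     (\<Sum>j. pochhammer \<gamma> j * z ^ j / (fact j * Gamma (a * real j + b)))"

definition elastic_density :: "real \<Rightarrow> real \<Rightarrow> real \<Rightarrow> real" where
  "elastic_density \<alpha> t s =
     2 * exp (\<alpha> * s) *
       (LBINT w:{s..}. w * exp (- \<alpha> * w) * (exp (- w\<^sup>2 / (2 * t)) / sqrt (2 * pi * t ^ 3)))"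

definition elastic_atom :: "real \<Rightarrow> real \<Rightarrow> real" where
  "elastic_atom \<alpha> t =
     1 - 2 * exp (\<alpha>\<^sup>2 * t / 2) *
       (LBINT w:{\<alpha> * sqrt t..}. exp (- w\<^sup>2 / 2) / sqrt (2 * pi))"

text \<open>
  The one-dimensional law at time \<open>t\<close> of the elastic Brownian motion with absorbing rate
  \<open>\<alpha>\<close>, started at the origin: an absolutely continuous part on the half line
  (the paths not yet absorbed) plus the mass \<open>elastic_atom \<alpha> t\<close> at \<open>0\<close> (the absorbed ones).
\<close>
definition elastic_law :: "real \<Rightarrow> real \<Rightarrow> real measure" where
  "elastic_law \<alpha> t = measure_of UNIV (sets borel)
     (\<lambda>A. (\<integral>\<^sup>+ s. ennreal (elastic_density \<alpha> t s) * indicator (A \<inter> {0..}) s \<partial>lborel)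
          + ennreal (elastic_atom \<alpha> t) * indicator A 0)"

lemma sets_elastic_law [simp, measurable_cong]: "sets (elastic_law \<alpha> t) = sets borel"
  unfolding elastic_law_def by (rule sets.sets_measure_of_eq[of borel, unfolded space_borel])

lemma borel_measurable_elastic_density [measurable]:
  "elastic_density \<alpha> t \<in> borel_measurable borel"
proof -
  define f where "f = (\<lambda>w. w * exp (- \<alpha> * w) * (exp (- w\<^sup>2 / (2 * t)) / sqrt (2 * pi * t ^ 3)))"
  have [measurable]: "f \<in> borel_measurable borel"
    unfolding f_def by simp
  have "(\<lambda>s. \<integral>w. (if s \<le> w then f w else 0) \<partial>lborel) \<in> borel_measurable borel"
    by (rule lborel.borel_measurable_lebesgue_integral) measurable
  moreover have "elastic_density \<alpha> t =
      (\<lambda>s. 2 * exp (\<alpha> * s) * (\<integral>w. (if s \<le> w then f w else 0) \<partial>lborel))"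
    unfolding elastic_density_def set_lebesgue_integral_def f_def
    by (intro ext arg_cong2[where f = "(*)"] refl Bochner_Integration.integral_cong)
      (auto simp: indicator_def)
  ultimately show ?thesis by simp
qed

lemma emeasure_elastic_law:
  assumes "A \<in> sets borel"
  shows "emeasure (elastic_law \<alpha> t) A =
    (\<integral>\<^sup>+ s. ennreal (elastic_density \<alpha> t s) * indicator (A \<inter> {0..}) s \<partial>lborel)
      + ennreal (elastic_atom \<alpha> t) * indicator A 0"
proof -
  define N where "N = density lborel (\<lambda>s. ennreal (elastic_density \<alpha> t s) * indicator {0..} s)"
  define R where "R = density (return borel (0::real)) (\<lambda>_. ennreal (elastic_atom \<alpha> t))"
  have N: "(\<integral>\<^sup>+ s. ennreal (elastic_density \<alpha> t s) * indicator (A \<inter> {0..}) s \<partial>lborel) = emeasure N A"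
    if "A \<in> sets borel" for A
    using that unfolding N_def
    by (subst emeasure_density) (auto intro!: nn_integral_cong simp: indicator_def)
  have R: "ennreal (elastic_atom \<alpha> t) * indicator A 0 = emeasure R A" if "A \<in> sets borel" for A
    using that unfolding R_def by (simp add: emeasure_density nn_integral_return)
  have "countably_additive (sets borel)
     (\<lambda>A. (\<integral>\<^sup>+ s. ennreal (elastic_density \<alpha> t s) * indicator (A \<inter> {0..}) s \<partial>lborel)
          + ennreal (elastic_atom \<alpha> t) * indicator A 0)"
  proof (rule countably_additiveI)
    fix F :: "nat \<Rightarrow> real set"
    assume F: "range F \<subseteq> sets borel" "disjoint_family F" "(\<Union>i. F i) \<in> sets borel"
    then have Fi: "F i \<in> sets borel" for i by auto
    have sN: "sets N = sets borel" and sR: "sets R = sets borel"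
      by (simp_all add: N_def R_def)
    have "(\<Sum>i. emeasure N (F i) + emeasure R (F i)) = emeasure N (\<Union>i. F i) + emeasure R (\<Union>i. F i)"
      using F sN sR by (simp add: suminf_add[symmetric] suminf_emeasure)
    then show "(\<Sum>i. (\<integral>\<^sup>+ s. ennreal (elastic_density \<alpha> t s) * indicator (F i \<inter> {0..}) s \<partial>lborel)
          + ennreal (elastic_atom \<alpha> t) * indicator (F i) 0) =
        (\<integral>\<^sup>+ s. ennreal (elastic_density \<alpha> t s) * indicator ((\<Union>i. F i) \<inter> {0..}) s \<partial>lborel)
          + ennreal (elastic_atom \<alpha> t) * indicator (\<Union>i. F i) 0"
      by (simp add: N R Fi F(3))
  qed
  moreover have "sigma_algebra UNIV (sets (borel :: real measure))"
    using sets.sigma_algebra_axioms[of "borel :: real measure"] by simp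
  ultimately show ?thesis
    unfolding elastic_law_def using assms
    by (intro emeasure_measure_of_sigma) (auto simp: positive_def)
qed

end

theory Submission
  imports Defs
begin

text \<open>
  Writing \<open>n\<^sub>t\<close> for the density of \<open>N(0, t)\<close>, the tail of the elastic law at \<open>g > 0\<close> is
  \<open>2 \<integral>\<^bsub>w > g\<^esub> e\<^bsup>-\<alpha>(w - g)\<^esup> n\<^sub>t(w) dw\<close>, so the probability that the elastic Brownian motion
  reaches \<open>G\<close> is, up to the factor \<open>\<lambda>\<^sup>k / \<Gamma>(k)\<close>, the integral of \<open>e\<^bsup>-\<lambda>g - \<alpha>(w - g)\<^esup>\<close> against the
  measure \<open>2 g\<^bsup>k - 1\<^esup> n\<^sub>t(w) dg dw\<close> on the wedge \<open>0 < g < w\<close>. Expanding the exponential and then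
  the binomial leaves the moments of \<open>g\<^sup>j (w - g)\<^sup>l\<close>, which are Beta integrals times moments of the
  half-normal law; Legendre duplication turns them into \<open>\<Gamma>(k + j) l! / \<Gamma>((k + j + l) / 2 + 1)\<close>.
  The same expansion with \<open>|\<lambda>|\<close>, \<open>|\<alpha>|\<close> in place of \<open>-\<lambda>\<close>, \<open>-\<alpha>\<close> has nonnegative terms and a finite sum,
  so the double series converges absolutely and may be summed by rows or along diagonals.
\<close>

section \<open>Gamma function, half-normal moments and Beta integrals\<close>

lemma Gamma_legendre_duplication_real:
  assumes "x > (0::real)"
  shows "Gamma x * Gamma (x + 1/2) = 2 powr (1 - 2 * x) * sqrt pi * Gamma (2 * x)"
proof -
  have "complex_of_real (Gamma x * Gamma (x + 1/2)) = Gamma (of_real x) * Gamma (of_real x + 1/2)"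
    using Gamma_complex_of_real[of x] Gamma_complex_of_real[of "x + 1/2"] by simp
  also have "\<dots> = exp ((1 - 2 * of_real x) * of_real (ln 2)) * of_real (sqrt pi) * Gamma (2 * of_real x)"
    using assms by (intro Gamma_legendre_duplication) (auto elim!: nonpos_Ints_cases simp: complex_eq_iff)
  also have "\<dots> = complex_of_real (2 powr (1 - 2 * x) * sqrt pi * Gamma (2 * x))"
    using Gamma_complex_of_real[of "2 * x"] by (simp add: powr_def exp_of_real[symmetric])
  finally show ?thesis unfolding of_real_eq_iff .
qed

text \<open>The substitution x = w^2 / (2 t) maps the open half line onto itself and turns the
  moment into Euler's integral for \<open>Gamma ((m + 1) / 2)\<close>; m > -1 gives its convergence
  at 0.\<close>

lemma nn_integral_half_line_moment:
  assumes "t > 0" "m > -1"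
  shows "(\<integral>\<^sup>+ w. ennreal (indicator {0<..} w * (w powr m * (2 * normal_density 0 (sqrt t) w))) \<partial>lborel)
       = ennreal ((2 * t) powr (m / 2) * Gamma ((m + 1) / 2) / sqrt pi)"
proof -
  define g where "g = (\<lambda>w::real. w\<^sup>2 / (2 * t))"
  define f where "f = (\<lambda>x::real. x powr ((m + 1) / 2 - 1) / exp x)"
  \<comment> \<open>\<open>c\<close> is chosen so that \<open>c\<close> times the transformed Euler
    integrand, with Jacobian w / t, is the integrand of the moment.\<close>
  define c where "c = (2 * t) powr (m / 2) / sqrt pi"
  have img: "g ` {0<..} = {0<..}"
  proof safe
    fix y :: real assume "y > 0"
    then show "y \<in> g ` {0<..}"
      using assms(1) by (intro image_eqI[of _ _ "sqrt (2 * t * y)"]) (auto simp: g_def)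
  qed (use assms(1) in \<open>auto simp: g_def\<close>)
  have "(f has_integral Gamma ((m + 1) / 2)) {0..}"
    unfolding f_def using assms(2) by (intro Gamma_integral_real) auto
  \<comment> \<open>Euler's integral comes on \<open>{0..}\<close>, while \<open>g\<close> is used
    as a bijection of \<open>{0<..}\<close>; the two sets differ by a null set.\<close>
  moreover have "negligible {x \<in> {0..} - {0<..}. f x \<noteq> 0}" "negligible {x \<in> {0<..} - {0..}. f x \<noteq> 0}"
    by (rule negligible_subset[of "{0}"]; auto)+
  ultimately have f: "(f has_integral Gamma ((m + 1) / 2)) {0<..}"
    using has_integral_spike_set_eq by blast
  have fa: "f absolutely_integrable_on g ` {0<..}"
    unfolding img using f by (intro nonnegative_absolutely_integrable_1) (auto simp: f_def integrable_on_def)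
  have "(g has_field_derivative w / t) (at w within {0<..})" for w
    unfolding g_def using assms(1) by (auto intro!: derivative_eq_intros)
  moreover have "inj_on g {0<..}"
    using assms(1) by (auto simp: g_def inj_on_def)
  ultimately have "(\<lambda>w. \<bar>w / t\<bar> * f (g w)) absolutely_integrable_on {0<..} \<and>
      integral {0<..} (\<lambda>w. \<bar>w / t\<bar> * f (g w)) = Gamma ((m + 1) / 2)
      \<longleftrightarrow> f absolutely_integrable_on g ` {0<..} \<and> integral (g ` {0<..}) f = Gamma ((m + 1) / 2)"
    by (intro has_absolute_integral_change_of_variables_1') auto
  moreover have "integral (g ` {0<..}) f = Gamma ((m + 1) / 2)"
    unfolding img using f by (rule integral_unique)
  ultimately have "(\<lambda>w. \<bar>w / t\<bar> * f (g w)) absolutely_integrable_on {0<..} \<and>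
      integral {0<..} (\<lambda>w. \<bar>w / t\<bar> * f (g w)) = Gamma ((m + 1) / 2)"
    using fa by blast
  then have "((\<lambda>w. \<bar>w / t\<bar> * f (g w)) has_integral Gamma ((m + 1) / 2)) {0<..}"
    by (auto simp: has_integral_iff absolutely_integrable_on_def)
  then have "((\<lambda>w. c * (\<bar>w / t\<bar> * f (g w))) has_integral (c * Gamma ((m + 1) / 2))) {0<..}"
    by (rule has_integral_mult_right)
  moreover have "c * (\<bar>w / t\<bar> * f (g w)) = w powr m * (2 * normal_density 0 (sqrt t) w)" if "w \<in> {0<..}" for w
  proof -
    have w: "w > 0" using that by simp
    have "g w powr ((m + 1) / 2 - 1) = (w powr 2) powr ((m - 1) / 2) / (2 * t) powr ((m - 1) / 2)"
      using w assms(1) by (simp add: g_def powr_divide field_simps)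
    also have "\<dots> = w powr (m - 1) / (2 * t) powr ((m - 1) / 2)"
      unfolding powr_powr by (metis mult.commute nonzero_eq_divide_eq zero_neq_numeral)
    finally have 1: "g w powr ((m + 1) / 2 - 1) = w powr (m - 1) / (2 * t) powr ((m - 1) / 2)" .
    have 2: "w * w powr (m - 1) = w powr m" using w by (simp add: powr_diff)
    have 3: "(2 * t) powr (m / 2) = (2 * t) powr ((m - 1) / 2) * sqrt (2 * t)"
      using assms(1) by (simp add: powr_half_sqrt[symmetric] powr_add[symmetric] add_divide_distrib[symmetric])
    \<comment> \<open>Together with 1 / sqrt pi from \<open>c\<close> this is twice the normalising
      constant 1 / sqrt (2 pi t) of the normal density.\<close>
    have 4: "sqrt (2 * t) / t = 2 / sqrt (2 * t)" using assms(1)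
      by (simp add: field_simps real_sqrt_mult)
    have "c * (\<bar>w / t\<bar> * f (g w)) = sqrt (2 * t) / t * (w * w powr (m - 1)) * exp (- (w\<^sup>2) / (2 * t)) / sqrt pi"
      using w assms(1) unfolding f_def 1 c_def 3
      by (simp add: field_simps exp_minus) (simp add: g_def exp_minus)
    also have "\<dots> = w powr m * (2 * normal_density 0 (sqrt t) w)"
      unfolding 2 4 normal_density_def using assms(1) by (simp add: real_sqrt_mult field_simps)
    finally show ?thesis .
  qed
  ultimately have "((\<lambda>w. w powr m * (2 * normal_density 0 (sqrt t) w)) has_integral c * Gamma ((m + 1) / 2)) {0<..}"
    by (rule has_integral_eq[rotated])
  from nn_integral_has_integral_lebesgue[OF _ this] show ?thesis
    by (simp add: c_def field_simps)
qed

text \<open>Scaling g = w x reduces to the unit interval; the two powers and the Jacobian contribute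
  w^(a - 1), w^(b - 1) and w.\<close>

lemma nn_integral_Beta:
  assumes "a > 0" "b > 0" "w > (0::real)"
  shows "(\<integral>\<^sup>+ g. ennreal (indicator {0<..<w} g * (g powr (a - 1) * (w - g) powr (b - 1))) \<partial>lborel)
       = ennreal (Beta a b * w powr (a + b - 1))"
proof -
  have "((\<lambda>x. x powr (a - 1) * (1 - x) powr (b - 1)) has_integral Beta a b) {0<..<1}"
    using has_integral_Beta_real[OF assms(1,2)] by (simp only: has_integral_Icc_iff_Ioo)
  from nn_integral_has_integral_lebesgue[OF _ this]
  have *: "(\<integral>\<^sup>+ x. ennreal (indicator {0<..<1} x * (x powr (a - 1) * (1 - x) powr (b - 1))) \<partial>lborel) = Beta a b"
    by simp
  have "(\<integral>\<^sup>+ g. ennreal (indicator {0<..<w} g * (g powr (a - 1) * (w - g) powr (b - 1))) \<partial>lborel)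
     = ennreal \<bar>w\<bar> * (\<integral>\<^sup>+ x. ennreal (indicator {0<..<w} (0 + w * x) * ((0 + w * x) powr (a - 1) * (w - (0 + w * x)) powr (b - 1))) \<partial>lborel)"
    using assms(3) by (intro nn_integral_real_affine) auto
  also have "\<dots> = ennreal w * (\<integral>\<^sup>+ x. ennreal (w powr (a + b - 2)) * ennreal (indicator {0<..<1} x * (x powr (a - 1) * (1 - x) powr (b - 1))) \<partial>lborel)"
  proof -
    have "indicator {0<..<w} (0 + w * x) * ((0 + w * x) powr (a - 1) * (w - (0 + w * x)) powr (b - 1))
        = w powr (a + b - 2) * (indicator {0<..<1} x * (x powr (a - 1) * (1 - x) powr (b - 1)))" for x
    proof (cases "x \<in> {0<..<1}")
      case True
      have "w - w * x = w * (1 - x)" by (simp add: algebra_simps)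
      moreover have "w * x < w" using True assms(3) by simp
      moreover have "w powr (a + b - 2) = w powr (a - 1) * w powr (b - 1)"
        by (simp add: powr_add[symmetric])
      ultimately show ?thesis using True assms(3)
        by (simp add: powr_mult)
    next
      case False
      then have "w * x \<notin> {0<..<w}" using assms(3) by (auto simp: zero_less_mult_iff)
      then show ?thesis using False by simp
    qed
    then show ?thesis using assms(3) by (simp add: ennreal_mult)
  qed
  also have "\<dots> = ennreal w * (ennreal (w powr (a + b - 2)) * ennreal (Beta a b))"
    by (simp add: nn_integral_cmult *)
  also have "\<dots> = ennreal (Beta a b * w powr (a + b - 1))"
  proof -
    have "w * w powr (a + b - 2) = w powr (a + b - 1)"
      using assms(3) by (simp add: powr_mult_base)
    then show ?thesis using assms by (simp add: ennreal_mult'[symmetric] Beta_def Gamma_real_pos mult_ac)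
  qed
  finally show ?thesis .
qed

section \<open>The wedge measure, its moments and exponential integrability\<close>

text \<open>Only the power g^(k - 1) of the Gamma density and the half-normal density enter. The
  exponentials and the factor lam^k / Gamma k stay in the integrand, so one measure serves all rates
  and its polynomial moments are explicit.\<close>

definition wedge_measure :: "real \<Rightarrow> real \<Rightarrow> (real \<times> real) measure" where
  "wedge_measure k t = density (lborel \<Otimes>\<^sub>M lborel)
     (\<lambda>(g, w). ennreal (if 0 < g \<and> g < w then g powr (k - 1) * (2 * normal_density 0 (sqrt t) w) else 0))"

lemma sets_wedge_measure [simp, measurable_cong]:
  "sets (wedge_measure k t) = sets (borel \<Otimes>\<^sub>M borel)"
  unfolding wedge_measure_def by (simp cong: sets_pair_measure_cong)

text \<open>Tonelli with g innermost: for products of powers a Beta integral comes first and a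
  half-normal moment second. The sign condition is confined to the wedge, since powers of w - g may
  be negative outside it, where the density vanishes.\<close>

lemma nn_integral_wedge_measure:
  assumes [measurable]: "case_prod f \<in> borel_measurable (borel \<Otimes>\<^sub>M borel)"
    and "\<And>g w. 0 < g \<Longrightarrow> g < w \<Longrightarrow> 0 \<le> f g w"
  shows "(\<integral>\<^sup>+ x. ennreal (case_prod f x) \<partial>wedge_measure k t) =
    (\<integral>\<^sup>+ w. ennreal (indicator {0<..} w * (2 * normal_density 0 (sqrt t) w)) *
      (\<integral>\<^sup>+ g. ennreal (indicator {0<..<w} g * (g powr (k - 1) * f g w)) \<partial>lborel) \<partial>lborel)"
proof -
  have "(\<integral>\<^sup>+ x. ennreal (case_prod f x) \<partial>wedge_measure k t) =
    (\<integral>\<^sup>+ x. (\<lambda>(g, w). ennreal (if 0 < g \<and> g < w then g powr (k - 1) * (2 * normal_density 0 (sqrt t) w) else 0)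
       * ennreal (f g w)) x \<partial>(lborel \<Otimes>\<^sub>M lborel))"
    unfolding wedge_measure_def by (subst nn_integral_density) (auto simp: case_prod_beta')
  also have "\<dots> = (\<integral>\<^sup>+ w. \<integral>\<^sup>+ g. (\<lambda>(g, w). ennreal (if 0 < g \<and> g < w then g powr (k - 1) * (2 * normal_density 0 (sqrt t) w) else 0)
       * ennreal (f g w)) (g, w) \<partial>lborel \<partial>lborel)"
    by (subst lborel_pair.nn_integral_snd) auto
  also have "\<dots> = (\<integral>\<^sup>+ w. \<integral>\<^sup>+ g. ennreal (indicator {0<..} w * (2 * normal_density 0 (sqrt t) w)) *
      ennreal (indicator {0<..<w} g * (g powr (k - 1) * f g w)) \<partial>lborel \<partial>lborel)"
    using assms(2)
    by (intro nn_integral_cong) (auto simp: indicator_def ennreal_mult'[symmetric] mult_ac)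
  also have "\<dots> = (\<integral>\<^sup>+ w. ennreal (indicator {0<..} w * (2 * normal_density 0 (sqrt t) w)) *
      (\<integral>\<^sup>+ g. ennreal (indicator {0<..<w} g * (g powr (k - 1) * f g w)) \<partial>lborel) \<partial>lborel)"
    by (intro nn_integral_cong nn_integral_cmult) measurable
  finally show ?thesis .
qed

lemma AE_wedge_measure: "AE (g, w) in wedge_measure k t. 0 < g \<and> g < w"
proof -
  have "AE x in lborel \<Otimes>\<^sub>M lborel. 0 < (case x of (g, w) \<Rightarrow> ennreal (if 0 < g \<and> g < w
      then g powr (k - 1) * (2 * normal_density 0 (sqrt t) w) else 0)) \<longrightarrow> (case x of (g, w) \<Rightarrow> 0 < g \<and> g < w)"
    by (intro always_eventually) (auto split: if_splits)
  then show ?thesis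
    unfolding wedge_measure_def by (subst AE_density) (auto simp: case_prod_beta')
qed

text \<open>For fixed w > 0 the g-integral is \<open>Beta (k + j) (l + 1) * w powr m\<close> with m
  = k + j + l, and a half-normal moment of order m remains. Legendre duplication at (m + 1) / 2
  cancels the Gamma (m + 1) in the denominator of Beta and leaves Gamma (m / 2 + 1).\<close>

lemma wedge_measure_moment:
  assumes "k > 0" "t > 0"
  shows "has_bochner_integral (wedge_measure k t) (\<lambda>(g, w). g ^ j * (w - g) ^ l)
    (Gamma (k + real j) * fact l * (t / 2) powr ((k + real j + real l) / 2)
      / Gamma ((k + real j + real l) / 2 + 1))" (is "has_bochner_integral _ _ ?v")
proof -
  define m where "m = k + real j + real l"
  have m: "m > 0" using assms by (simp add: m_def)
  have "(\<integral>\<^sup>+ x. ennreal (case_prod (\<lambda>g w. g ^ j * (w - g) ^ l) x) \<partial>wedge_measure k t) =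
    (\<integral>\<^sup>+ w. ennreal (indicator {0<..} w * (2 * normal_density 0 (sqrt t) w)) *
      (\<integral>\<^sup>+ g. ennreal (indicator {0<..<w} g * (g powr (k - 1) * (g ^ j * (w - g) ^ l))) \<partial>lborel) \<partial>lborel)"
    by (intro nn_integral_wedge_measure) auto
  also have "\<dots> = (\<integral>\<^sup>+ w. ennreal (indicator {0<..} w * (2 * normal_density 0 (sqrt t) w)) *
      ennreal (Beta (k + j) (real l + 1) * w powr m) \<partial>lborel)"
  proof (intro nn_integral_cong)
    fix w :: real
    show "ennreal (indicator {0<..} w * (2 * normal_density 0 (sqrt t) w)) *
      (\<integral>\<^sup>+ g. ennreal (indicator {0<..<w} g * (g powr (k - 1) * (g ^ j * (w - g) ^ l))) \<partial>lborel) =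
      ennreal (indicator {0<..} w * (2 * normal_density 0 (sqrt t) w)) * ennreal (Beta (k + j) (real l + 1) * w powr m)"
    proof (cases "w > 0")
      case True
      have "(\<integral>\<^sup>+ g. ennreal (indicator {0<..<w} g * (g powr (k - 1) * (g ^ j * (w - g) ^ l))) \<partial>lborel)
         = (\<integral>\<^sup>+ g. ennreal (indicator {0<..<w} g * (g powr ((k + j) - 1) * (w - g) powr ((real l + 1) - 1))) \<partial>lborel)"
        by (intro nn_integral_cong)
           (auto simp: indicator_def powr_add[symmetric] powr_realpow[symmetric] algebra_simps)
      also have "\<dots> = ennreal (Beta (k + j) (real l + 1) * w powr (k + j + (real l + 1) - 1))"
        using assms True by (intro nn_integral_Beta) auto
      finally show ?thesis by (simp add: m_def add.assoc)
    qed auto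
  qed
  also have "\<dots> = (\<integral>\<^sup>+ w. ennreal (Beta (k + j) (real l + 1)) *
     ennreal (indicator {0<..} w * (w powr m * (2 * normal_density 0 (sqrt t) w))) \<partial>lborel)"
    using assms by (intro nn_integral_cong)
      (auto simp: indicator_def ennreal_mult'[symmetric] Beta_def Gamma_real_pos mult_ac)
  also have "\<dots> = ennreal (Beta (k + j) (real l + 1)) * ennreal ((2 * t) powr (m / 2) * Gamma ((m + 1) / 2) / sqrt pi)"
    using m assms by (simp add: nn_integral_cmult nn_integral_half_line_moment)
  also have "\<dots> = ennreal (Beta (k + j) (real l + 1) * ((2 * t) powr (m / 2) * Gamma ((m + 1) / 2) / sqrt pi))"
    using assms by (intro ennreal_mult'[symmetric]) (auto simp: Beta_def Gamma_real_pos)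
  also have "Beta (k + j) (real l + 1) * ((2 * t) powr (m / 2) * Gamma ((m + 1) / 2) / sqrt pi) = ?v"
  proof -
    have B: "Beta (k + j) (real l + 1) = Gamma (k + j) * fact l / Gamma (m + 1)"
      by (simp add: Beta_def m_def Gamma_fact add_ac)
    have "Gamma ((m + 1) / 2) * Gamma ((m + 1) / 2 + 1 / 2) = 2 powr (1 - 2 * ((m + 1) / 2)) * sqrt pi * Gamma (2 * ((m + 1) / 2))"
      using m by (intro Gamma_legendre_duplication_real) auto
    moreover have "(m + 1) / 2 + 1 / 2 = m / 2 + 1" "1 - 2 * ((m + 1) / 2) = - m"
      "2 * ((m + 1) / 2) = m + 1" by (simp_all add: field_simps)
    ultimately have "Gamma ((m + 1) / 2) * Gamma (m / 2 + 1) = 2 powr (- m) * sqrt pi * Gamma (m + 1)" by (simp only:)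
    moreover have "Gamma (m / 2 + 1) > 0" "Gamma (m + 1) > 0" using m by (auto intro!: Gamma_real_pos)
    ultimately have 1: "Gamma ((m + 1) / 2) / (sqrt pi * Gamma (m + 1)) = 2 powr (- m) / Gamma (m / 2 + 1)"
      by (simp add: field_simps)
    \<comment> \<open>The factor 2^(-m) from duplication turns 2 t into t / 2, hence the scale sqrt
      t / sqrt 2 in the final series.\<close>
    have 2: "(2 * t) powr (m / 2) * 2 powr (- m) = (t / 2) powr (m / 2)"
    proof -
      have "(2 * t) powr (m / 2) = (4 * (t / 2)) powr (m / 2)" by simp
      also have "\<dots> = (2 powr 2) powr (m / 2) * (t / 2) powr (m / 2)"
        using assms by (subst powr_mult) auto
      also have "(2 powr 2) powr (m / 2) = (2::real) powr m" by (simp only: powr_powr) simp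
      finally show ?thesis by (simp add: powr_minus field_simps)
    qed
    have "Beta (k + j) (real l + 1) * ((2 * t) powr (m / 2) * Gamma ((m + 1) / 2) / sqrt pi)
      = Gamma (k + j) * fact l * (2 * t) powr (m / 2) * (Gamma ((m + 1) / 2) / (sqrt pi * Gamma (m + 1)))"
      unfolding B by (simp add: mult_ac)
    also have "\<dots> = Gamma (k + j) * fact l * ((2 * t) powr (m / 2) * 2 powr (- m)) / Gamma (m / 2 + 1)"
      unfolding 1 by simp
    finally show ?thesis unfolding 2 unfolding m_def .
  qed
  finally have "(\<integral>\<^sup>+ x. ennreal (case_prod (\<lambda>g w. g ^ j * (w - g) ^ l) x) \<partial>wedge_measure k t) = ennreal ?v" .
  moreover have "AE x in wedge_measure k t. 0 \<le> (case x of (g, w) \<Rightarrow> g ^ j * (w - g) ^ l)"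
    using AE_wedge_measure by eventually_elim auto
  moreover have "Gamma (k + real j) > 0" "Gamma (m / 2 + 1) > 0"
    using m assms by (auto intro!: Gamma_real_pos)
  then have "?v \<ge> 0"
    unfolding m_def by auto
  ultimately show ?thesis
    by (intro has_bochner_integral_nn_integral) auto
qed

text \<open>This supplies the dominating function for the exponential series. Gaussian decay wins:
  the g-integral is at most a multiple of e^(k w), and completing the square leaves a multiple of
  the normal density with mean (k + c) t.\<close>

lemma integrable_wedge_measure_exp:
  assumes "k > 0" "t > 0"
  shows "integrable (wedge_measure k t) (\<lambda>(g, w). exp (c * w))"
proof -
  have "(\<integral>\<^sup>+ x. ennreal (case_prod (\<lambda>g w. exp (c * w)) x) \<partial>wedge_measure k t) =
    (\<integral>\<^sup>+ w. ennreal (indicator {0<..} w * (2 * normal_density 0 (sqrt t) w)) *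
      (\<integral>\<^sup>+ g. ennreal (indicator {0<..<w} g * (g powr (k - 1) * exp (c * w))) \<partial>lborel) \<partial>lborel)"
    by (intro nn_integral_wedge_measure) auto
  also have "\<dots> \<le> (\<integral>\<^sup>+ w. ennreal (2 * Beta k 1 * exp ((k + c)\<^sup>2 * t / 2) * normal_density ((k + c) * t) (sqrt t) w) \<partial>lborel)"
  proof (intro nn_integral_mono)
    fix w :: real
    show "ennreal (indicator {0<..} w * (2 * normal_density 0 (sqrt t) w)) *
      (\<integral>\<^sup>+ g. ennreal (indicator {0<..<w} g * (g powr (k - 1) * exp (c * w))) \<partial>lborel)
      \<le> ennreal (2 * Beta k 1 * exp ((k + c)\<^sup>2 * t / 2) * normal_density ((k + c) * t) (sqrt t) w)"
    proof (cases "w > 0")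
      case True
      \<comment> \<open>With second Beta parameter 1 the factor \<open>(w - g) powr 0\<close> is 1
        on the open interval.\<close>
      have "(\<integral>\<^sup>+ g. ennreal (indicator {0<..<w} g * (g powr (k - 1) * exp (c * w))) \<partial>lborel)
         = (\<integral>\<^sup>+ g. ennreal (exp (c * w)) * ennreal (indicator {0<..<w} g * (g powr (k - 1) * (w - g) powr (1 - 1))) \<partial>lborel)"
        by (intro nn_integral_cong) (auto simp: indicator_def ennreal_mult'[symmetric])
      also have "\<dots> = ennreal (exp (c * w)) * ennreal (Beta k 1 * w powr (k + 1 - 1))"
        using assms True by (subst nn_integral_cmult) (simp_all only: nn_integral_Beta zero_less_one, measurable)
      finally have "(\<integral>\<^sup>+ g. ennreal (indicator {0<..<w} g * (g powr (k - 1) * exp (c * w))) \<partial>lborel)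
         = ennreal (exp (c * w)) * ennreal (Beta k 1 * w powr k)" by simp
      then have "ennreal (indicator {0<..} w * (2 * normal_density 0 (sqrt t) w)) *
      (\<integral>\<^sup>+ g. ennreal (indicator {0<..<w} g * (g powr (k - 1) * exp (c * w))) \<partial>lborel)
        = ennreal (2 * normal_density 0 (sqrt t) w * exp (c * w) * (Beta k 1 * w powr k))"
        using True assms by (simp add: ennreal_mult'[symmetric] Beta_def Gamma_real_pos mult_ac)
      also have "\<dots> \<le> ennreal (2 * normal_density 0 (sqrt t) w * exp (c * w) * (Beta k 1 * exp (k * w)))"
      proof -
        \<comment> \<open>Here \<open>w powr k\<close> is exp (k ln w) and ln w \<le> w; the cruder
          bound merges with \<open>exp (c * w)\<close>.\<close>
        have "w powr k \<le> exp (k * w)"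
          using True assms ln_bound[of w] by (simp add: powr_def)
        then show ?thesis using assms
          by (intro ennreal_leI mult_left_mono) (auto simp: Beta_def Gamma_real_pos less_imp_le)
      qed
      also have "2 * normal_density 0 (sqrt t) w * exp (c * w) * (Beta k 1 * exp (k * w)) =
         2 * Beta k 1 * exp ((k + c)\<^sup>2 * t / 2) * normal_density ((k + c) * t) (sqrt t) w"
      proof -
        have "- (w\<^sup>2) / (2 * t) + (c * w + k * w) = (k + c)\<^sup>2 * t / 2 + - (w - (k + c) * t)\<^sup>2 / (2 * t)"
          using assms by (simp add: field_simps power2_eq_square)
        then have "exp (- (w\<^sup>2) / (2 * t)) * (exp (c * w) * exp (k * w)) =
          exp ((k + c)\<^sup>2 * t / 2) * exp (- (w - (k + c) * t)\<^sup>2 / (2 * t))"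
          by (simp only: exp_add[symmetric])
        then show ?thesis using assms unfolding normal_density_def by (simp add: field_simps)
      qed
      finally show ?thesis .
    qed auto
  qed
  also have "\<dots> < \<infinity>"
  proof -
    have "integrable lborel (\<lambda>w. 2 * Beta k 1 * exp ((k + c)\<^sup>2 * t / 2) * normal_density ((k + c) * t) (sqrt t) w)"
      using assms by (intro integrable_mult_right integrable_normal_density) auto
    moreover have "Beta k 1 \<ge> 0"
      using assms by (auto simp: Beta_def intro!: divide_nonneg_nonneg mult_nonneg_nonneg less_imp_le[OF Gamma_real_pos])
    ultimately have "(\<integral>\<^sup>+ w. ennreal (2 * Beta k 1 * exp ((k + c)\<^sup>2 * t / 2) * normal_density ((k + c) * t) (sqrt t) w) \<partial>lborel)
      = ennreal (\<integral>w. 2 * Beta k 1 * exp ((k + c)\<^sup>2 * t / 2) * normal_density ((k + c) * t) (sqrt t) w \<partial>lborel)"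
      by (intro nn_integral_eq_integral) auto
    then show ?thesis by (simp only: ennreal_less_top infinity_ennreal_def)
  qed
  finally have "(\<integral>\<^sup>+ x. ennreal (case_prod (\<lambda>g w. exp (c * w)) x) \<partial>wedge_measure k t) < \<infinity>" .
  then show ?thesis
    by (intro integrableI_nonneg) auto
qed

section \<open>The double series: integration term by term and absolute convergence\<close>

text \<open>Up to the factor \<open>Gamma k * (t / 2) powr (k / 2)\<close>, this is the (j, l)
  moment times p^j q^l / (j! l!), with x and y equal to p and q times sqrt (t / 2). The argument is
  a pair so that unordered sums over all pairs apply.\<close>

definition double_coeff :: "real \<Rightarrow> real \<Rightarrow> real \<Rightarrow> nat \<times> nat \<Rightarrow> real" where
  "double_coeff k x y = (\<lambda>(j, l). pochhammer k j / fact j * x ^ j * y ^ l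
     / Gamma ((k + real j + real l) / 2 + 1))"

text \<open>The binomial theorem reduces this to moments. The n! cancels, the l! of the moment
  cancels the other factorial, Gamma (k + j) / Gamma k is a Pochhammer symbol, and the remaining
  power of t / 2 is absorbed into the two arguments.\<close>

lemma wedge_measure_binomial_moment:
  assumes "k > 0" "t > 0"
  shows "has_bochner_integral (wedge_measure k t) (\<lambda>(g, w). (p * g + q * (w - g)) ^ n / fact n)
    (Gamma k * (t / 2) powr (k / 2) *
      (\<Sum>j\<le>n. double_coeff k (p * sqrt (t / 2)) (q * sqrt (t / 2)) (j, n - j)))"
proof -
  define s where "s = sqrt (t / 2)"
  have "has_bochner_integral (wedge_measure k t)
      (\<lambda>x. \<Sum>j\<le>n. p ^ j * q ^ (n - j) / (fact j * fact (n - j)) * (case x of (g, w) \<Rightarrow> g ^ j * (w - g) ^ (n - j)))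
      (\<Sum>j\<le>n. p ^ j * q ^ (n - j) / (fact j * fact (n - j)) *
        (Gamma (k + real j) * fact (n - j) * (t / 2) powr ((k + real j + real (n - j)) / 2)
          / Gamma ((k + real j + real (n - j)) / 2 + 1)))"
    by (intro has_bochner_integral_sum has_bochner_integral_mult_right wedge_measure_moment assms)
  moreover have "(\<Sum>j\<le>n. p ^ j * q ^ (n - j) / (fact j * fact (n - j)) * (case x of (g, w) \<Rightarrow> g ^ j * (w - g) ^ (n - j)))
      = (case x of (g, w) \<Rightarrow> (p * g + q * (w - g)) ^ n / fact n)" for x
  proof (cases x)
    case (Pair g w)
    show ?thesis
      unfolding Pair prod.case binomial_ring sum_divide_distrib
      by (intro sum.cong refl) (simp add: binomial_fact power_mult_distrib)
  qed
  moreover have "p ^ j * q ^ l / (fact j * fact l) *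
        (Gamma (k + real j) * fact l * (t / 2) powr ((k + real j + real l) / 2)
          / Gamma ((k + real j + real l) / 2 + 1))
      = Gamma k * (t / 2) powr (k / 2) * double_coeff k (p * s) (q * s) (j, l)" for j l
  proof -
    have "k \<notin> \<int>\<^sub>\<le>\<^sub>0" using assms by (auto elim!: nonpos_Ints_cases)
    moreover have "Gamma k \<noteq> 0" using Gamma_real_pos[OF assms(1)] by linarith
    ultimately have 1: "Gamma (k + real j) = pochhammer k j * Gamma k"
      by (simp add: pochhammer_Gamma)
    have "s ^ (j + l) = s powr (real (j + l))"
      using assms by (intro powr_realpow[symmetric]) (simp add: s_def)
    also have "\<dots> = (t / 2) powr ((real j + real l) / 2)"
      using assms unfolding s_def by (simp add: powr_half_sqrt[symmetric] powr_powr)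
    finally have 2: "(t / 2) powr ((k + real j + real l) / 2) = (t / 2) powr (k / 2) * (s ^ j * s ^ l)"
      by (simp add: powr_add power_add add_divide_distrib)
    have "fact l \<noteq> (0 :: real)" by simp
    then show ?thesis
      unfolding double_coeff_def 1 2 by (simp add: power_mult_distrib mult_ac)
  qed
  ultimately show ?thesis
    unfolding s_def[symmetric] sum_distrib_left by (simp only:)
qed

text \<open>The exponential series is integrated term by term, by dominated convergence with bound
  exp ((|p| + |q|) w). The signs of p and q are left free: negative rates give the probability,
  absolute values give summability.\<close>

lemma double_coeff_diagonal_sums_integral:
  assumes "k > 0" "t > 0"
  shows "(\<lambda>n. Gamma k * (t / 2) powr (k / 2) *
      (\<Sum>j\<le>n. double_coeff k (p * sqrt (t / 2)) (q * sqrt (t / 2)) (j, n - j))) sums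
    (\<integral>(g, w). exp (p * g + q * (w - g)) \<partial>wedge_measure k t)"
proof -
  let ?W = "wedge_measure k t"
  define h :: "real \<times> real \<Rightarrow> real" where "h = (\<lambda>(g, w). p * g + q * (w - g))"
  have h [measurable]: "h \<in> borel_measurable (borel \<Otimes>\<^sub>M borel)"
    unfolding h_def by measurable
  have moment: "has_bochner_integral ?W (\<lambda>x. h x ^ n / fact n) (Gamma k * (t / 2) powr (k / 2) *
      (\<Sum>j\<le>n. double_coeff k (p * sqrt (t / 2)) (q * sqrt (t / 2)) (j, n - j)))" for n
    using wedge_measure_binomial_moment[OF assms, of p q n] by (simp add: h_def case_prod_beta')
  have "(\<lambda>N. \<integral>x. (\<Sum>n<N. h x ^ n / fact n) \<partial>?W) \<longlonglongrightarrow> (\<integral>x. exp (h x) \<partial>?W)"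
  proof (rule integral_dominated_convergence)
    show "integrable ?W (\<lambda>(g, w). exp ((\<bar>p\<bar> + \<bar>q\<bar>) * w))"
      by (rule integrable_wedge_measure_exp[OF assms])
    have "(\<lambda>N. \<Sum>n<N. y ^ n / fact n) \<longlonglongrightarrow> exp y" for y :: real
      using exp_converges[of y] by (simp add: sums_def field_simps)
    then show "AE x in ?W. (\<lambda>N. \<Sum>n<N. h x ^ n / fact n) \<longlonglongrightarrow> exp (h x)"
      by simp
    \<comment> \<open>A bound uniform in \<open>N\<close>: the triangle inequality, then truncation
      of a series with nonnegative terms.\<close>
    have bound: "norm (\<Sum>n<N. y ^ n / fact n) \<le> exp \<bar>y\<bar>" for y :: real and N
    proof -
      have "norm (\<Sum>n<N. y ^ n / fact n) \<le> (\<Sum>n<N. \<bar>y\<bar> ^ n / fact n)"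
        by (rule order_trans[OF norm_sum]) (simp add: power_abs)
      also have "\<dots> \<le> exp \<bar>y\<bar>"
        using exp_converges[of "\<bar>y\<bar>"]
        by (intro sum_le_suminf[where I = "{..<N}", THEN order_trans])
           (auto simp: sums_iff field_simps)
      finally show ?thesis .
    qed
    show "AE x in ?W. norm (\<Sum>n<N. h x ^ n / fact n) \<le> (case x of (g, w) \<Rightarrow> exp ((\<bar>p\<bar> + \<bar>q\<bar>) * w))" for N
      using AE_wedge_measure
    proof eventually_elim
      case (elim x)
      obtain g w where x: "x = (g, w)" by (cases x)
      have gw: "0 < g" "g < w" using elim x by auto
      have "\<bar>h x\<bar> \<le> \<bar>p\<bar> * g + \<bar>q\<bar> * (w - g)"
        using gw abs_triangle_ineq[of "p * g" "q * (w - g)"] by (simp add: h_def x abs_mult)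
      \<comment> \<open>Both g and w - g lie between 0 and w.\<close>
      also have "\<dots> \<le> \<bar>p\<bar> * w + \<bar>q\<bar> * w"
        using gw by (intro add_mono mult_left_mono) auto
      finally have "exp \<bar>h x\<bar> \<le> exp ((\<bar>p\<bar> + \<bar>q\<bar>) * w)"
        by (simp add: algebra_simps)
      with bound[where y = "h x" and N = N]
      have "norm (\<Sum>n<N. h x ^ n / fact n) \<le> exp ((\<bar>p\<bar> + \<bar>q\<bar>) * w)"
        by (rule order_trans)
      then show ?case by (simp add: x)
    qed
  qed auto
  moreover have "(\<integral>x. (\<Sum>n<N. h x ^ n / fact n) \<partial>?W) = (\<Sum>n<N. Gamma k * (t / 2) powr (k / 2) *
      (\<Sum>j\<le>n. double_coeff k (p * sqrt (t / 2)) (q * sqrt (t / 2)) (j, n - j)))" for N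
    using moment by (intro has_bochner_integral_integral_eq has_bochner_integral_sum)
  ultimately show ?thesis
    by (simp add: sums_def h_def case_prod_beta')
qed

text \<open>Taking absolute values of x and y makes every term nonnegative without changing its
  size. The diagonal sums then form a convergent series, as they expand a finite integral, and for
  nonnegative terms this gives unordered summability.\<close>

lemma double_coeff_abs_summable:
  assumes "k > 0"
  shows "(\<lambda>z. norm (double_coeff k x y z)) summable_on UNIV"
proof -
  let ?c = "double_coeff k \<bar>x\<bar> \<bar>y\<bar>"
  have G: "Gamma ((k + real j + real l) / 2 + 1) > 0" for j l
    using assms by (intro Gamma_real_pos add_nonneg_pos) auto
  then have nonneg: "?c z \<ge> 0" for z
    using assms pochhammer_nonneg[of k]
    by (auto simp: double_coeff_def less_imp_le split: prod.splits)
  have norm: "norm (double_coeff k x y z) = ?c z" for z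
  proof (cases z)
    case (Pair j l)
    have "pochhammer k j \<ge> 0" using assms by (intro pochhammer_nonneg) auto
    then show ?thesis
      using abs_of_pos[OF G] by (simp add: Pair double_coeff_def abs_mult power_abs)
  qed
  \<comment> \<open>At t = 2 the scale sqrt (t / 2) is 1, so p and q are |x| and |y| themselves; the
    nonzero factor Gamma k cancels.\<close>
  have "summable (\<lambda>n. \<Sum>j\<le>n. ?c (j, n - j))"
    using double_coeff_diagonal_sums_integral[OF assms, of 2 "\<bar>x\<bar>" "\<bar>y\<bar>", THEN sums_summable] Gamma_real_pos[OF assms]
    by (simp add: summable_cmult_iff)
  then have "(\<lambda>n. \<Sum>j\<le>n. ?c (j, n - j)) summable_on UNIV"
    by (intro summable_nonneg_imp_summable_on sum_nonneg nonneg)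
  then have "(\<lambda>(n, j). ?c (j, n - j)) summable_on (SIGMA n:UNIV. {..n})"
    by (intro summable_on_SigmaI[where g = "\<lambda>n. \<Sum>j\<le>n. ?c (j, n - j)"]) (auto simp: nonneg)
  \<comment> \<open>The map (n, j) to (j, n - j) identifies the triangle j \<le> n with all
    pairs.\<close>
  then have "?c summable_on UNIV"
    by (subst (asm) summable_on_reindex_bij_witness
      [where i = "\<lambda>(j, l). (j + l, j)" and j = "\<lambda>(n, j). (j, n - j)" and T = UNIV and h = ?c]) auto
  then show ?thesis unfolding norm .
qed

text \<open>An unordered sum may be grouped at will: by diagonals, as the integral produces it, or
  by rows, as the Mittag-Leffler functions require. The common value \<open>S\<close> links the
  two.\<close>

lemma double_coeff_sums:
  fixes k x y :: real
  assumes "k > 0"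
  defines "S \<equiv> infsum (double_coeff k x y) UNIV"
  shows "(\<lambda>n. \<Sum>j\<le>n. double_coeff k x y (j, n - j)) sums S"
    and "summable (\<lambda>j. double_coeff k x y (j, l))"
    and "(\<lambda>l. \<Sum>j. double_coeff k x y (j, l)) sums S"
proof -
  let ?c = "double_coeff k x y"
  have c: "(?c has_sum S) UNIV"
    unfolding S_def by (rule has_sum_infsum[OF abs_summable_summable[OF double_coeff_abs_summable[OF assms(1)]]])
  have "((\<lambda>(n, j). ?c (j, n - j)) has_sum S) (SIGMA n:UNIV. {..n})"
    using c by (subst has_sum_reindex_bij_witness
      [where i = "\<lambda>(j, l). (j + l, j)" and j = "\<lambda>(n, j). (j, n - j)" and T = UNIV and h = ?c and s' = S]) auto
  then have "((\<lambda>n. \<Sum>j\<le>n. ?c (j, n - j)) has_sum S) UNIV"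
    by (rule has_sum_SigmaD) (simp add: has_sum_finite)
  then show "(\<lambda>n. \<Sum>j\<le>n. ?c (j, n - j)) sums S"
    by (rule has_sum_imp_sums)
  \<comment> \<open>The swap makes l the outer index, so that j is summed first at fixed l.\<close>
  have sw: "((\<lambda>(l, j). ?c (j, l)) has_sum S) (UNIV \<times> UNIV)"
    using c by (subst has_sum_reindex_bij_witness
      [where i = prod.swap and j = prod.swap and T = UNIV and h = ?c and s' = S]) auto
  have row: "(\<lambda>j. ?c (j, l)) summable_on UNIV" for l
    using summable_on_SigmaD1[of "\<lambda>l j. ?c (j, l)" UNIV "\<lambda>_. UNIV" l] sw
    by (auto simp: summable_on_def)
  then have row': "((\<lambda>j. ?c (j, l)) has_sum (\<Sum>j. ?c (j, l))) UNIV" for l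
    by (metis has_sum_imp_sums has_sum_infsum sums_unique)
  show "summable (\<lambda>j. ?c (j, l))"
    using has_sum_imp_sums[OF row'] by (rule sums_summable)
  show "(\<lambda>l. \<Sum>j. ?c (j, l)) sums S"
    using sw row' by (intro has_sum_imp_sums has_sum_SigmaD[OF sw]) auto
qed

section \<open>Rows and diagonals as Mittag-Leffler series\<close>

text \<open>These are the coefficients in (1 - z)^(-k) (1 - z)^(-1) = (1 - z)^(-(k + 1)); they raise
  the upper parameter from k to k + 1 when the rates coincide.\<close>

lemma sum_pochhammer_over_fact:
  "(\<Sum>j\<le>n. pochhammer k j / fact j) = pochhammer (k + 1) n / (fact n :: real)"
proof (induction n)
  case (Suc n)
  \<comment> \<open>\<open>P\<close> stands for \<open>pochhammer (k + 1) n\<close>; the new summand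
    has numerator \<open>pochhammer k (Suc n)\<close>, which is k times \<open>P\<close>.\<close>
  have "P / fact n + k * P / fact (Suc n) = P * (k + 1 + real n) / fact (Suc n)" for P
    by (simp add: divide_simps) (simp add: algebra_simps)
  with Suc show ?case
    by (simp only: sum.atMost_Suc pochhammer_rec[of k] pochhammer_Suc[of "k + 1"])
qed simp

text \<open>At fixed l the Gamma argument is j / 2 + ((l + k) / 2 + 1). Convergence of the row
  allows y^l to be moved inside the series.\<close>

lemma power_mult_gen_mittag_leffler:
  assumes "k > 0"
  shows "y ^ l * gen_mittag_leffler k (1/2) ((real l + k) / 2 + 1) x = (\<Sum>j. double_coeff k x y (j, l))"
proof -
  have "double_coeff k x y (j, l) = y ^ l * double_coeff k x 1 (j, l)" for j
    by (simp add: double_coeff_def)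
  moreover have "double_coeff k x 1 (j, l) =
      pochhammer k j * x ^ j / (fact j * Gamma (1/2 * real j + ((real l + k) / 2 + 1)))" for j
    by (simp add: double_coeff_def add_ac add_divide_distrib)
  ultimately show ?thesis
    unfolding gen_mittag_leffler_def
    using suminf_mult[OF double_coeff_sums(2)[OF assms, of x 1 l], of "y ^ l"] by (simp only:)
qed

text \<open>With equal arguments the power and the Gamma value depend on n only, so just the
  coefficients (k)_j / j! are summed.\<close>

lemma sum_diagonal_double_coeff:
  "(\<Sum>j\<le>n. double_coeff k x x (j, n - j)) =
     pochhammer (k + 1) n * x ^ n / (fact n * Gamma (1/2 * real n + (k / 2 + 1)))"
proof -
  have "(\<Sum>j\<le>n. double_coeff k x x (j, n - j)) =
      (\<Sum>j\<le>n. pochhammer k j / fact j) * (x ^ n / Gamma (1/2 * real n + (k / 2 + 1)))"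
    unfolding sum_distrib_right
  proof (intro sum.cong refl)
    fix j assume "j \<in> {..n}"
    then have 1: "x ^ j * x ^ (n - j) = x ^ n"
      and 2: "(k + real j + real (n - j)) / 2 + 1 = 1/2 * real n + (k / 2 + 1)"
      by (auto simp: power_add[symmetric] field_simps)
    have "double_coeff k x x (j, n - j) =
        pochhammer k j / fact j * (x ^ j * x ^ (n - j)) / Gamma ((k + real j + real (n - j)) / 2 + 1)"
      by (simp add: double_coeff_def)
    then show "double_coeff k x x (j, n - j) =
        pochhammer k j / fact j * (x ^ n / Gamma (1/2 * real n + (k / 2 + 1)))"
      unfolding 1 2 by simp
  qed
  then show ?thesis by (simp add: sum_pochhammer_over_fact)
qed

section \<open>The tail of the elastic law\<close>

text \<open>Since sqrt (2 pi t^3) = t sqrt (2 pi t), the integrand is minus the derivative of twice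
  the normal density, which vanishes at infinity.\<close>

lemma nn_integral_normal_density_tail:
  assumes "t > 0" "s \<ge> 0"
  shows "(\<integral>\<^sup>+ v. ennreal (2 * v * (exp (- v\<^sup>2 / (2 * t)) / sqrt (2 * pi * t ^ 3))) * indicator {s..} v \<partial>lborel)
    = ennreal (2 * normal_density 0 (sqrt t) s)"
proof -
  have t3: "sqrt (2 * pi * t ^ 3) = t * sqrt (2 * pi * t)"
    using assms(1) by (simp add: power3_eq_cube real_sqrt_mult)
  have "((\<lambda>x. - 2 * normal_density 0 (sqrt t) x) has_real_derivative
      2 * v * (exp (- v\<^sup>2 / (2 * t)) / sqrt (2 * pi * t ^ 3))) (at v)" for v
    unfolding normal_density_def t3 using assms(1)
    by (auto intro!: derivative_eq_intros simp: field_simps)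
  moreover have "((\<lambda>x. - 2 * normal_density 0 (sqrt t) x) \<longlongrightarrow> 0) at_top"
  proof -
    have "filterlim (\<lambda>x::real. 1 / (2 * t) * x\<^sup>2) at_top at_top"
      using assms(1)
      by (intro filterlim_tendsto_pos_mult_at_top[OF tendsto_const] filterlim_pow_at_top filterlim_ident) auto
    then have "((\<lambda>x. exp (- (1 / (2 * t) * x\<^sup>2))) \<longlongrightarrow> 0) at_top"
      by (intro filterlim_compose[OF exp_at_bot]) (simp add: filterlim_uminus_at_bot)
    then have "((\<lambda>x. - 2 / sqrt (2 * pi * t) * exp (- (1 / (2 * t) * x\<^sup>2))) \<longlongrightarrow> - 2 / sqrt (2 * pi * t) * 0) at_top"
      by (rule tendsto_mult_left)
    then show ?thesis using assms(1) by (simp add: normal_density_def)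
  qed
  ultimately have "(\<integral>\<^sup>+ v. ennreal (2 * v * (exp (- v\<^sup>2 / (2 * t)) / sqrt (2 * pi * t ^ 3))) * indicator {s..} v \<partial>lborel)
    = ennreal (0 - (- 2 * normal_density 0 (sqrt t) s))"
    using assms by (intro nn_integral_FTC_atLeast) auto
  then show ?thesis by simp
qed

text \<open>This passes from the Bochner integral in the definition to a nonnegative integral fit
  for Tonelli. Integrability holds because the damping factor e^(-\<alpha> (v - s)) is at most 1 and
  the undamped tail is finite.\<close>

lemma ennreal_elastic_density:
  assumes "t > 0" "\<alpha> > 0" "s \<ge> 0"
  shows "ennreal (elastic_density \<alpha> t s) =
    (\<integral>\<^sup>+ v. ennreal (indicator {s..} v * (exp (- \<alpha> * (v - s)) *
       (2 * v * (exp (- v\<^sup>2 / (2 * t)) / sqrt (2 * pi * t ^ 3))))) \<partial>lborel)"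
proof -
  define f where "f = (\<lambda>v. indicator {s..} v * (exp (- \<alpha> * (v - s)) *
       (2 * v * (exp (- v\<^sup>2 / (2 * t)) / sqrt (2 * pi * t ^ 3)))) :: real)"
  have [measurable]: "f \<in> borel_measurable borel"
    unfolding f_def by measurable
  have nonneg: "f v \<ge> 0" for v
    using assms by (auto simp: f_def indicator_def)
  have "(\<integral>\<^sup>+ v. ennreal (f v) \<partial>lborel) \<le>
    (\<integral>\<^sup>+ v. ennreal (2 * v * (exp (- v\<^sup>2 / (2 * t)) / sqrt (2 * pi * t ^ 3))) * indicator {s..} v \<partial>lborel)"
  proof (intro nn_integral_mono)
    fix v :: real
    have "exp (- \<alpha> * (v - s)) * (2 * v * (exp (- v\<^sup>2 / (2 * t)) / sqrt (2 * pi * t ^ 3)))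
       \<le> 1 * (2 * v * (exp (- v\<^sup>2 / (2 * t)) / sqrt (2 * pi * t ^ 3)))" if "s \<le> v"
      using that assms by (intro mult_right_mono) (auto simp: mult_nonneg_nonneg)
    then show "ennreal (f v) \<le> ennreal (2 * v * (exp (- v\<^sup>2 / (2 * t)) / sqrt (2 * pi * t ^ 3))) * indicator {s..} v"
      unfolding f_def by (cases "s \<le> v") (auto intro!: ennreal_leI)
  qed
  also have "\<dots> < \<infinity>"
    unfolding nn_integral_normal_density_tail[OF assms(1,3)] by simp
  finally have "integrable lborel f"
    using nonneg by (intro integrableI_nonneg) auto
  then have "(\<integral>\<^sup>+ v. ennreal (f v) \<partial>lborel) = ennreal (\<integral>v. f v \<partial>lborel)"
    using nonneg by (intro nn_integral_eq_integral) auto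
  moreover have "elastic_density \<alpha> t s = (\<integral>v. f v \<partial>lborel)"
    unfolding elastic_density_def set_lebesgue_integral_def integral_mult_right_zero[symmetric] f_def
    by (intro Bochner_Integration.integral_cong) (auto simp: indicator_def exp_diff right_diff_distrib exp_minus field_simps)
  ultimately show ?thesis by (simp add: f_def)
qed

text \<open>After an exchange of integrals, s runs over [g, v], where v - s may be traded for s - g.
  The exponential is then free of v, and after exchanging back the v-integral collapses to twice the
  normal density at s.\<close>

lemma emeasure_elastic_law_atLeast:
  assumes "t > 0" "\<alpha> > 0" "g > 0"
  shows "emeasure (elastic_law \<alpha> t) {g..} =
    (\<integral>\<^sup>+ w. ennreal (indicator {g<..} w * (exp (- \<alpha> * (w - g)) * (2 * normal_density 0 (sqrt t) w))) \<partial>lborel)"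
proof -
  define r where "r = (\<lambda>v. 2 * v * (exp (- v\<^sup>2 / (2 * t)) / sqrt (2 * pi * t ^ 3)))"
  have [measurable]: "r \<in> borel_measurable borel"
    unfolding r_def by measurable
  have r: "r v \<ge> 0" if "v \<ge> 0" for v
    using that assms by (simp add: r_def)
  \<comment> \<open>As g > 0, the set \<open>{g..}\<close> excludes 0 and only the density
    contributes.\<close>
  have "emeasure (elastic_law \<alpha> t) {g..} =
      (\<integral>\<^sup>+ s. ennreal (elastic_density \<alpha> t s) * indicator {g..} s \<partial>lborel)"
    using assms(3) by (subst emeasure_elastic_law) (auto intro!: nn_integral_cong simp: indicator_def)
  also have "\<dots> = (\<integral>\<^sup>+ s. \<integral>\<^sup>+ v. ennreal ((if g \<le> s \<and> s \<le> v then exp (- \<alpha> * (v - s)) else 0) * r v) \<partial>lborel \<partial>lborel)"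
  proof (intro nn_integral_cong)
    fix s :: real
    show "ennreal (elastic_density \<alpha> t s) * indicator {g..} s =
        (\<integral>\<^sup>+ v. ennreal ((if g \<le> s \<and> s \<le> v then exp (- \<alpha> * (v - s)) else 0) * r v) \<partial>lborel)"
    proof (cases "g \<le> s")
      case True
      then show ?thesis
        using assms by (subst ennreal_elastic_density) (auto simp: r_def intro!: nn_integral_cong)
    qed auto
  qed
  also have "\<dots> = (\<integral>\<^sup>+ v. \<integral>\<^sup>+ s. ennreal ((if g \<le> s \<and> s \<le> v then exp (- \<alpha> * (v - s)) else 0) * r v) \<partial>lborel \<partial>lborel)"
    by (intro lborel_pair.Fubini') measurable
  also have "\<dots> = (\<integral>\<^sup>+ v. \<integral>\<^sup>+ s. ennreal ((if g \<le> s \<and> s \<le> v then exp (- \<alpha> * (s - g)) else 0) * r v) \<partial>lborel \<partial>lborel)"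
    \<comment> \<open>the reflection \<open>s \<mapsto> g + v - s\<close> of the interval \<open>[g, v]\<close>\<close>
  proof (rule nn_integral_cong)
    fix v :: real
    have "(\<integral>\<^sup>+ s. ennreal ((if g \<le> s \<and> s \<le> v then exp (- \<alpha> * (v - s)) else 0) * r v) \<partial>lborel)
      = ennreal \<bar>- 1\<bar> * (\<integral>\<^sup>+ s. ennreal ((if g \<le> (g + v) + (- 1) * s \<and> (g + v) + (- 1) * s \<le> v
          then exp (- \<alpha> * (v - ((g + v) + (- 1) * s))) else 0) * r v) \<partial>lborel)"
      by (intro nn_integral_real_affine) auto
    then show "(\<integral>\<^sup>+ s. ennreal ((if g \<le> s \<and> s \<le> v then exp (- \<alpha> * (v - s)) else 0) * r v) \<partial>lborel)
      = (\<integral>\<^sup>+ s. ennreal ((if g \<le> s \<and> s \<le> v then exp (- \<alpha> * (s - g)) else 0) * r v) \<partial>lborel)"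
      by (simp add: conj_commute cong del: if_weak_cong)
  qed
  also have "\<dots> = (\<integral>\<^sup>+ s. \<integral>\<^sup>+ v. ennreal ((if g \<le> s \<and> s \<le> v then exp (- \<alpha> * (s - g)) else 0) * r v) \<partial>lborel \<partial>lborel)"
    by (intro lborel_pair.Fubini'[symmetric]) measurable
  also have "\<dots> = (\<integral>\<^sup>+ s. ennreal (indicator {g<..} s * (exp (- \<alpha> * (s - g)) * (2 * normal_density 0 (sqrt t) s))) \<partial>lborel)"
  proof (intro nn_integral_cong_AE)
    \<comment> \<open>The closed condition g \<le> s and the open indicator differ at the single
      point s = g.\<close>
    have "AE s in lborel. s \<noteq> g" by (rule AE_lborel_singleton)
    then show "AE s in lborel. (\<integral>\<^sup>+ v. ennreal ((if g \<le> s \<and> s \<le> v then exp (- \<alpha> * (s - g)) else 0) * r v) \<partial>lborel)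
      = ennreal (indicator {g<..} s * (exp (- \<alpha> * (s - g)) * (2 * normal_density 0 (sqrt t) s)))"
    proof eventually_elim
      case (elim s)
      show ?case
      proof (cases "g < s")
        case True
        have "(\<integral>\<^sup>+ v. ennreal ((if g \<le> s \<and> s \<le> v then exp (- \<alpha> * (s - g)) else 0) * r v) \<partial>lborel)
          = (\<integral>\<^sup>+ v. ennreal (exp (- \<alpha> * (s - g))) * (ennreal (r v) * indicator {s..} v) \<partial>lborel)"
          using True assms r by (intro nn_integral_cong) (auto simp: ennreal_mult' indicator_def)
        also have "\<dots> = ennreal (exp (- \<alpha> * (s - g))) * ennreal (2 * normal_density 0 (sqrt t) s)"
          unfolding r_def using True assms
          by (subst nn_integral_cmult, measurable, subst nn_integral_normal_density_tail) auto
        finally show ?thesis using True by (simp add: ennreal_mult')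
      next
        case False
        then show ?thesis using elim by (auto simp: not_less)
      qed
    qed
  qed
  finally show ?thesis .
qed

section \<open>The crossing probability\<close>

text \<open>By independence the joint law is a product, and its section at G = g is the tail event
  \<open>{g..}\<close>. Weighting the tail formula by the Gamma density gives an iterated integral
  over the wedge 0 < g < w.\<close>

lemma prob_elastic_ge_gamma:
  fixes X G :: "'a \<Rightarrow> real"
  assumes "prob_space M" "lam > 0" "k > 0" "\<alpha> > 0" "t > 0"
    and G: "distributed M lborel G (gamma_density lam k)"
    and X: "distr M borel X = elastic_law \<alpha> t"
    and ind: "prob_space.indep_var M borel X borel G"
  shows "\<P>(\<omega> in M. G \<omega> \<le> X \<omega>) =
    lam powr k / Gamma k * (\<integral>(g, w). exp (- lam * g + - \<alpha> * (w - g)) \<partial>wedge_measure k t)"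
proof -
  interpret prob_space M by fact
  let ?W = "wedge_measure k t"
  define C where "C = lam powr k / Gamma k"
  have C: "C \<ge> 0"
    using assms by (simp add: C_def less_imp_le[OF Gamma_real_pos])
  have [measurable]: "X \<in> borel_measurable M" "G \<in> borel_measurable M"
    and pair: "distr M borel X \<Otimes>\<^sub>M distr M borel G = distr M (borel \<Otimes>\<^sub>M borel) (\<lambda>x. (X x, G x))"
    using ind by (auto simp: indep_var_distribution_eq)
  have [measurable]: "gamma_density lam k \<in> borel_measurable borel"
    unfolding gamma_density_def by measurable
  have dG: "distr M borel G = density lborel (\<lambda>x. ennreal (gamma_density lam k x))"
    using distributed_distr_eq_density[OF G] by (metis distr_cong sets_lborel)
  interpret XG: pair_prob_space "distr M borel X" "distr M borel G"
    by (simp add: pair_prob_space_def pair_sigma_finite_def prob_space_distr prob_space_imp_sigma_finite)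
  have "{z \<in> space (borel \<Otimes>\<^sub>M borel). snd z \<le> (fst z :: real)} \<in> sets (borel \<Otimes>\<^sub>M borel)"
    by measurable
  then have [measurable]: "{(x, g). g \<le> (x :: real)} \<in> sets (borel \<Otimes>\<^sub>M borel)"
    by (simp add: space_pair_measure case_prod_beta')
  have tail: "(\<lambda>x. (x, g)) -` {(x, g). g \<le> x} = {g..}" for g :: real
    by auto
  \<comment> \<open>Measurability of the tail in g is inherited from the sections of a
    product-measurable set.\<close>
  have "(\<lambda>g. emeasure (distr M borel X) ((\<lambda>x. (x, g)) -` {(x, g). g \<le> x})) \<in> borel_measurable (distr M borel G)"
    by (rule XG.measurable_emeasure_Pair2) simp
  then have [measurable]: "(\<lambda>g. emeasure (elastic_law \<alpha> t) {g..}) \<in> borel_measurable borel"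
    unfolding tail X by simp
  have "emeasure M {\<omega> \<in> space M. G \<omega> \<le> X \<omega>} = emeasure (distr M (borel \<Otimes>\<^sub>M borel) (\<lambda>x. (X x, G x))) {(x, g). g \<le> x}"
    by (subst emeasure_distr) (auto intro!: arg_cong[where f = "emeasure M"])
  also have "\<dots> = (\<integral>\<^sup>+ g. emeasure (elastic_law \<alpha> t) {g..} \<partial>density lborel (\<lambda>x. ennreal (gamma_density lam k x)))"
    unfolding pair[symmetric] X[symmetric] dG[symmetric] tail[symmetric]
    by (intro XG.emeasure_pair_measure_alt2) simp
  also have "\<dots> = (\<integral>\<^sup>+ g. ennreal (gamma_density lam k g) * emeasure (elastic_law \<alpha> t) {g..} \<partial>lborel)"
    by (intro nn_integral_density) auto
  also have "\<dots> = (\<integral>\<^sup>+ g. \<integral>\<^sup>+ w. (\<lambda>(g, w). ennreal (if 0 < g \<and> g < w then g powr (k - 1) * (2 * normal_density 0 (sqrt t) w) else 0)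
      * ennreal (C * exp (- lam * g + - \<alpha> * (w - g)))) (g, w) \<partial>lborel \<partial>lborel)"
  proof (intro nn_integral_cong)
    fix g :: real
    show "ennreal (gamma_density lam k g) * emeasure (elastic_law \<alpha> t) {g..} =
      (\<integral>\<^sup>+ w. (\<lambda>(g, w). ennreal (if 0 < g \<and> g < w then g powr (k - 1) * (2 * normal_density 0 (sqrt t) w) else 0)
      * ennreal (C * exp (- lam * g + - \<alpha> * (w - g)))) (g, w) \<partial>lborel)"
    \<comment> \<open>For g \<le> 0 both sides vanish, by the zero branch of
      \<open>gamma_density\<close>.\<close>
    proof (cases "g > 0")
      case True
      have e: "exp (- lam * g + - \<alpha> * (w - g)) = exp (- lam * g) * exp (- \<alpha> * (w - g))" for w
        by (rule exp_add)
      have "ennreal (gamma_density lam k g) * emeasure (elastic_law \<alpha> t) {g..} =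
        (\<integral>\<^sup>+ w. ennreal (gamma_density lam k g) *
           ennreal (indicator {g<..} w * (exp (- \<alpha> * (w - g)) * (2 * normal_density 0 (sqrt t) w))) \<partial>lborel)"
        using True assms by (simp add: emeasure_elastic_law_atLeast nn_integral_cmult)
      also have "\<dots> = (\<integral>\<^sup>+ w. (\<lambda>(g, w). ennreal (if 0 < g \<and> g < w then g powr (k - 1) * (2 * normal_density 0 (sqrt t) w) else 0)
      * ennreal (C * exp (- lam * g + - \<alpha> * (w - g)))) (g, w) \<partial>lborel)"
        using True C unfolding prod.case e
        by (intro nn_integral_cong)
           (auto simp: gamma_density_def C_def[symmetric] indicator_def ennreal_mult'[symmetric] mult_ac)
      finally show ?thesis .
    qed (simp add: gamma_density_def)
  qed
  also have "\<dots> = (\<integral>\<^sup>+ x. ennreal (C * (case x of (g, w) \<Rightarrow> exp (- lam * g + - \<alpha> * (w - g)))) \<partial>?W)"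
    unfolding wedge_measure_def
    by (subst lborel.nn_integral_fst, measurable, subst nn_integral_density)
       (auto simp: case_prod_beta')
  finally have *: "emeasure M {\<omega> \<in> space M. G \<omega> \<le> X \<omega>} =
     (\<integral>\<^sup>+ x. ennreal (C * (case x of (g, w) \<Rightarrow> exp (- lam * g + - \<alpha> * (w - g)))) \<partial>?W)" .
  have "\<P>(\<omega> in M. G \<omega> \<le> X \<omega>) = (\<integral>x. C * (case x of (g, w) \<Rightarrow> exp (- lam * g + - \<alpha> * (w - g))) \<partial>?W)"
    unfolding measure_def * using C
    by (intro integral_eq_nn_integral[symmetric]) (auto simp: case_prod_beta')
  then show ?thesis by (simp add: C_def)
qed

theorem theorem2p5:
  fixes M :: "'a measure" and Bel :: "real \<Rightarrow> 'a \<Rightarrow> real" and G :: "'a \<Rightarrow> real"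
    and lam k \<alpha> t :: real
  assumes "prob_space M"
    and "lam > 0" and "k > 0" and "\<alpha> > 0"
    and "distributed M lborel G (gamma_density lam k)"
    and "\<And>s. s > 0 \<Longrightarrow> Bel s \<in> borel_measurable M"
    and "\<And>s. s > 0 \<Longrightarrow> distr M borel (Bel s) = elastic_law \<alpha> s"
    and "\<And>s. s > 0 \<Longrightarrow> prob_space.indep_var M borel (Bel s) borel G"
    and "t > 0"
  shows "summable (\<lambda>l. (- \<alpha> * sqrt t / sqrt 2) ^ l *
           gen_mittag_leffler k (1/2) ((real l + k) / 2 + 1) (- lam * sqrt t / sqrt 2)) \<and>
         \<P>(\<omega> in M. Bel t \<omega> < G \<omega>) =
           1 - (lam * sqrt t / sqrt 2) powr k *
             (\<Sum>l. (- \<alpha> * sqrt t / sqrt 2) ^ l *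
               gen_mittag_leffler k (1/2) ((real l + k) / 2 + 1) (- lam * sqrt t / sqrt 2)) \<and>
         (\<alpha> = lam \<longrightarrow>
           \<P>(\<omega> in M. Bel t \<omega> < G \<omega>) =
             1 - (lam * sqrt t / sqrt 2) powr k *
               gen_mittag_leffler (k + 1) (1/2) (k / 2 + 1) (- lam * sqrt t / sqrt 2))"
proof -
  interpret prob_space M by fact
  let ?x = "- lam * sqrt t / sqrt 2" and ?y = "- \<alpha> * sqrt t / sqrt 2"
  define S where "S = infsum (double_coeff k ?x ?y) UNIV"
  note sums = double_coeff_sums[OF assms(3), of ?x ?y, folded S_def]
  have iterated: "(\<lambda>l. ?y ^ l * gen_mittag_leffler k (1/2) ((real l + k) / 2 + 1) ?x) sums S"
    unfolding power_mult_gen_mittag_leffler[OF assms(3)] by (rule sums(3))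
  have [measurable]: "Bel t \<in> borel_measurable M" "G \<in> borel_measurable M"
    using assms(6)[OF assms(9)] distributed_measurable[OF assms(5)] by simp_all
  have "(\<lambda>n. Gamma k * (t / 2) powr (k / 2) * (\<Sum>j\<le>n. double_coeff k ?x ?y (j, n - j))) sums
      (\<integral>(g, w). exp (- lam * g + - \<alpha> * (w - g)) \<partial>wedge_measure k t)"
    using double_coeff_diagonal_sums_integral[OF assms(3,9), of "- lam" "- \<alpha>"]
    by (simp add: real_sqrt_divide)
  \<comment> \<open>The same diagonal series also sums to a multiple of \<open>S\<close>; uniqueness
    of limits evaluates the integral.\<close>
  moreover have "(\<lambda>n. Gamma k * (t / 2) powr (k / 2) * (\<Sum>j\<le>n. double_coeff k ?x ?y (j, n - j))) sums
      (Gamma k * (t / 2) powr (k / 2) * S)"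
    by (intro sums_mult sums(1))
  ultimately have integral: "(\<integral>(g, w). exp (- lam * g + - \<alpha> * (w - g)) \<partial>wedge_measure k t)
      = Gamma k * (t / 2) powr (k / 2) * S"
    by (rule sums_unique2)
  have "(t / 2) powr (k / 2) = sqrt (t / 2) powr k"
    using assms(9) by (simp add: powr_half_sqrt[symmetric] powr_powr)
  then have "lam powr k * (t / 2) powr (k / 2) = (lam * sqrt t / sqrt 2) powr k"
    using assms(2,9) by (simp add: powr_mult[symmetric] real_sqrt_divide)
  \<comment> \<open>The Gamma k of the moments cancels the normalisation of the Gamma
    density.\<close>
  moreover have "\<P>(\<omega> in M. G \<omega> \<le> Bel t \<omega>) = lam powr k * (t / 2) powr (k / 2) * S"
    using prob_elastic_ge_gamma[OF assms(1-4,9,5) assms(7,8)[OF assms(9)]] Gamma_real_pos[OF assms(3)]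
    unfolding integral by simp
  ultimately have "\<P>(\<omega> in M. G \<omega> \<le> Bel t \<omega>) = (lam * sqrt t / sqrt 2) powr k * S"
    by simp
  moreover have "\<P>(\<omega> in M. Bel t \<omega> < G \<omega>) = 1 - \<P>(\<omega> in M. G \<omega> \<le> Bel t \<omega>)"
    by (subst prob_neg[symmetric]) (auto simp: not_le)
  ultimately have prob: "\<P>(\<omega> in M. Bel t \<omega> < G \<omega>) = 1 - (lam * sqrt t / sqrt 2) powr k * S"
    by simp
  \<comment> \<open>For equal rates the two arguments \<open>?x\<close> and \<open>?y\<close>
    coincide, so the diagonal sums have closed form.\<close>
  have "S = gen_mittag_leffler (k + 1) (1/2) (k / 2 + 1) ?x" if "\<alpha> = lam"
    using sums(1) unfolding that sum_diagonal_double_coeff gen_mittag_leffler_def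
    by (rule sums_unique)
  with prob iterated show ?thesis
    unfolding sums_iff by metis
qed

end
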